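(* Let $U$ be an open, $O(5)$-invariant set of real antisymmetric $5\times5$ matrices, let $\mathcal V$ be a smooth real function on an open set containing $I(U)\subset\mathbb R$, where $I(\Lambda)=6\left(4\,\mathrm{tr}\,\Lambda^4-(\mathrm{tr}\,\Lambda^2)^2\right)$, and suppose that the map $$\Lambda\mapsto B(\Lambda),\qquad B_{ij}=-\Lambda_{ij}+\mathcal V'(I(\Lambda))\,\frac{\partial I}{\partial\Lambda^{ij}}$$ is a diffeomorphism of $U$ onto an open set, with inverse $B\mapsto\Lambda(B)$. Define $$\mathcal H(B)=\frac14B_{ij}B^{ij}-\frac12\left(\Lambda_{ij}(B)+B_{ij}\right)\left(\Lambda^{ij}(B)+B^{ij}\right)+\mathcal V\left(I(\Lambda(B))\right).$$ Then $H_{ij}:=2\,\partial\mathcal H/\partial B^{ij}$ satisfies $$H_{ij}=-B_{ij}-2\Lambda_{ij}(B)\qquad\text{and}\qquad \varepsilon^{ijklm}H_{jk}H_{lm}=\varepsilon^{ijklm}B_{jk}B_{lm}.$$ Equivalently to the latter, written as a function of $s$ and $p$ (where $s>p>0$), $\mathcal H$ satisfies $$\mathcal H_s^2+\frac{2s}p\mathcal H_s\mathcal H_p+\mathcal H_p^2=1 .$$ Thus the PST gauge (relativistic) invariance condition holds identically for any choice of $\mathcal V(I)$.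
   Context: Indices $i,j,\dots=1,\dots,5$ are raised with $\delta^{ij}$; this Euclidean 5-space is the orthogonal complement of the unit timelike vector $v^\mu$ in six-dimensional space-time, at a point, and antisymmetric tensors such as $B_{\mu\nu},\Lambda_{\mu\nu}$ annihilated by $v^\mu$ are identified with antisymmetric $5\times5$ matrices. Derivatives with respect to antisymmetric matrices are antisymmetric and normalized by $\delta f=\frac{\partial f}{\partial B^{ij}}\delta B^{ij}$ (sum over all $i,j$). Explicitly $\frac{\partial I}{\partial\Lambda^{ij}}=-24\left(4(\Lambda^3)_{ij}+\Lambda_{ij}\Lambda_{kl}\Lambda^{kl}\right)$. $O(5)$ acts by conjugation. The invariants are $s=\frac14B_{ij}B^{ij}$ and $p=\sqrt{p_ip^i}$ with $p_i=\frac18\varepsilon_{ijklm}B^{jk}B^{lm}$; one has $s\ge p\ge0$. *)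

theory Defs
  imports "HOL-Analysis.Analysis"
begin

section \<open>Antisymmetric matrices and derivatives with respect to them\<close>

type_synonym mat5 = "real ^ 5 ^ 5"

definition asym_mats :: "mat5 set" where
  "asym_mats = {A. transpose A = - A}"

text \<open>The inner product of the library on matrices is the full contraction
  \<open>(\<Sum>i. \<Sum>j. A $ i $ j * B $ i $ j)\<close>, i.e. \<open>A\<^sub>i\<^sub>jB\<^sup>i\<^sup>j\<close>. The derivative of \<open>f\<close> along
  antisymmetric matrices is thus the antisymmetric \<open>G\<close> with \<open>\<delta>f = G\<^sub>i\<^sub>j \<delta>X\<^sup>i\<^sup>j\<close>, summed over
  all \<open>i, j\<close>.\<close>

definition has_asym_grad :: "(mat5 \<Rightarrow> real) \<Rightarrow> mat5 \<Rightarrow> mat5 \<Rightarrow> bool" where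
  "has_asym_grad f G X \<longleftrightarrow>
     G \<in> asym_mats \<and> (f has_derivative (\<lambda>dX. G \<bullet> dX)) (at X within asym_mats)"

definition asym_grad :: "(mat5 \<Rightarrow> real) \<Rightarrow> mat5 \<Rightarrow> mat5" where
  "asym_grad f X = (THE G. has_asym_grad f G X)"

section \<open>Smooth maps\<close>

text \<open>Here \<open>S\<close> is meant to be a relatively open subset of the linear subspace \<open>T\<close>. Derivatives
  within \<open>S\<close> are then determined on the directions \<open>v \<in> T\<close>, the only ones that are used.\<close>

primrec Ck_on :: "nat \<Rightarrow> 'a::real_normed_vector set \<Rightarrow> 'a set \<Rightarrow> ('a \<Rightarrow> 'b::real_normed_vector) \<Rightarrow> bool"
  where
    "Ck_on 0 T S f \<longleftrightarrow> continuous_on S f"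
  | "Ck_on (Suc k) T S f \<longleftrightarrow>
       (\<forall>x\<in>S. f differentiable (at x within S)) \<and>
       (\<forall>v\<in>T. Ck_on k T S (\<lambda>x. frechet_derivative f (at x within S) v))"

definition smooth_on ::
    "'a::real_normed_vector set \<Rightarrow> 'a set \<Rightarrow> ('a \<Rightarrow> 'b::real_normed_vector) \<Rightarrow> bool" where
  "smooth_on T S f \<longleftrightarrow> (\<forall>k. Ck_on k T S f)"

definition diffeomorphism_on ::
    "'a::real_normed_vector set \<Rightarrow> 'a set \<Rightarrow> 'a set \<Rightarrow> ('a \<Rightarrow> 'a) \<Rightarrow> ('a \<Rightarrow> 'a) \<Rightarrow> bool" where
  "diffeomorphism_on T U W f g \<longleftrightarrow>
     homeomorphism U W f g \<and> smooth_on T U f \<and> smooth_on T W g"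

definition O5_invariant :: "mat5 set \<Rightarrow> bool" where
  "O5_invariant U \<longleftrightarrow> (\<forall>R X. orthogonal_matrix R \<longrightarrow> X \<in> U \<longrightarrow> R ** X ** transpose R \<in> U)"

section \<open>The Levi-Civita symbol and the invariants\<close>

text \<open>The elements of the index type \<open>5\<close> are \<open>1, 2, 3, 4, 5\<close>, where \<open>5 = 0\<close>; the update at \<open>5\<close>
  below is the one at the fifth index, and \<open>levi_civita 1 2 3 4 5 = 1\<close>.\<close>

definition levi_civita :: "5 \<Rightarrow> 5 \<Rightarrow> 5 \<Rightarrow> 5 \<Rightarrow> 5 \<Rightarrow> real" where
  "levi_civita i j k l m =
     (let \<pi> = (\<lambda>_. i)(2 := j, 3 := k, 4 := l, 5 := m)
      in if bij \<pi> then of_int (sign \<pi>) else 0)"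

definition eps_contr :: "mat5 \<Rightarrow> mat5 \<Rightarrow> real ^ 5" where
  "eps_contr X Y =
     (\<chi> i. \<Sum>j\<in>UNIV. \<Sum>k\<in>UNIV. \<Sum>l\<in>UNIV. \<Sum>m\<in>UNIV. levi_civita i j k l m * X $ j $ k * Y $ l $ m)"

definition s_inv :: "mat5 \<Rightarrow> real" where
  "s_inv B = 1/4 * (B \<bullet> B)"

definition p_vec :: "mat5 \<Rightarrow> real ^ 5" where
  "p_vec B = (1/8) *\<^sub>R eps_contr B B"

definition p_inv :: "mat5 \<Rightarrow> real" where
  "p_inv B = sqrt (p_vec B \<bullet> p_vec B)"

definition I_inv :: "mat5 \<Rightarrow> real" where
  "I_inv L = 6 * (4 * trace (L ** L ** L ** L) - (trace (L ** L))\<^sup>2)"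

section \<open>The auxiliary-field map and the Hamiltonian\<close>

definition B_map :: "(real \<Rightarrow> real) \<Rightarrow> mat5 \<Rightarrow> mat5" where
  "B_map V L = - L + deriv V (I_inv L) *\<^sub>R asym_grad I_inv L"

definition Ham :: "(real \<Rightarrow> real) \<Rightarrow> (mat5 \<Rightarrow> mat5) \<Rightarrow> mat5 \<Rightarrow> real" where
  "Ham V Lam B =
     1/4 * (B \<bullet> B) - 1/2 * ((Lam B + B) \<bullet> (Lam B + B)) + V (I_inv (Lam B))"

definition H_field :: "(mat5 \<Rightarrow> real) \<Rightarrow> mat5 \<Rightarrow> mat5" where
  "H_field F B = 2 *\<^sub>R asym_grad F B"

definition PST_cond :: "(mat5 \<Rightarrow> real) \<Rightarrow> mat5 \<Rightarrow> bool" where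
  "PST_cond F B \<longleftrightarrow> eps_contr (H_field F B) (H_field F B) = eps_contr B B"

definition PST_pde :: "(real \<Rightarrow> real \<Rightarrow> real) \<Rightarrow> real \<Rightarrow> real \<Rightarrow> bool" where
  "PST_pde h s p \<longleftrightarrow>
     (let hs = deriv (\<lambda>x. h x p) s; hp = deriv (\<lambda>y. h s y) p
      in hs\<^sup>2 + 2 * s / p * hs * hp + hp\<^sup>2 = 1)"

section \<open>Uniqueness of the antisymmetric derivative, and the derivative of the quartic invariant\<close>

lemma subspace_asym_mats: "subspace asym_mats"
proof -
  have "transpose (0 :: mat5) = - 0" "transpose (X + Y) = transpose X + transpose Y"
    "transpose (c *\<^sub>R X) = c *\<^sub>R transpose X" for X Y :: mat5 and c
    by (simp_all add: transpose_def vec_eq_iff)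
  then show ?thesis by (simp add: subspace_def asym_mats_def)
qed

lemma has_asym_grad_unique:
  assumes "has_asym_grad f G X" "has_asym_grad f G' X" "X \<in> asym_mats"
  shows "G = G'"
proof -
  define D where "D = G - G'"
  have D: "D \<in> asym_mats"
    using assms subspace_asym_mats unfolding D_def has_asym_grad_def by (auto intro: subspace_diff)
  have line: "((\<lambda>t::real. X + t *\<^sub>R D) has_derivative (\<lambda>t. t *\<^sub>R D)) (at 0)"
    by (auto intro!: derivative_eq_intros)
  have sub: "range (\<lambda>t::real. X + t *\<^sub>R D) \<subseteq> asym_mats"
    using subspace_asym_mats D assms(3) by (auto intro: subspace_add subspace_mul)
  have *: "((\<lambda>t. f (X + t *\<^sub>R D)) has_derivative (\<lambda>t. K \<bullet> (t *\<^sub>R D))) (at 0)"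
    if "has_asym_grad f K X" for K
  proof -
    have "(f has_derivative (\<lambda>dX. K \<bullet> dX)) (at (X + (0::real) *\<^sub>R D) within range (\<lambda>t::real. X + t *\<^sub>R D))"
      using that sub unfolding has_asym_grad_def by (auto intro: has_derivative_subset)
    from has_derivative_in_compose[OF line this] show ?thesis by simp
  qed
  have "(\<lambda>t::real. G \<bullet> (t *\<^sub>R D)) = (\<lambda>t. G' \<bullet> (t *\<^sub>R D))"
    using has_derivative_unique[OF *[OF assms(1)] *[OF assms(2)]] .
  from fun_cong[OF this, of 1] have "D \<bullet> D = 0"
    by (simp add: D_def inner_diff_left)
  then show ?thesis by (simp add: D_def)
qed

lemma asym_grad_eq: "has_asym_grad f G X \<Longrightarrow> X \<in> asym_mats \<Longrightarrow> asym_grad f X = G"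
  unfolding asym_grad_def using has_asym_grad_unique by blast

lemma trace_mult_asym:
  assumes "A \<in> asym_mats" shows "trace (A ** Y) = - (A \<bullet> Y)"
proof -
  have "A $ i $ j = - A $ j $ i" for i j
  proof -
    have "transpose A $ j $ i = (- A) $ j $ i"
      using assms by (simp only: asym_mats_def mem_Collect_eq)
    then show ?thesis by (simp add: transpose_def)
  qed
  then have *: "A $ i $ j * Y $ j $ i = - (A $ j $ i * Y $ j $ i)" for i j
    by (metis mult_minus_left)
  have "trace (A ** Y) = (\<Sum>i\<in>UNIV. \<Sum>j\<in>UNIV. - (A $ j $ i * Y $ j $ i))"
    by (simp add: trace_def matrix_matrix_mult_def *)
  also have "\<dots> = (\<Sum>j\<in>UNIV. \<Sum>i\<in>UNIV. - (A $ j $ i * Y $ j $ i))"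
    by (rule sum.swap)
  finally show ?thesis by (simp add: inner_vec_def sum_negf)
qed

lemma bilinear_mat5: "bounded_bilinear ((**) :: mat5 \<Rightarrow> mat5 \<Rightarrow> mat5)"
proof -
  have "bilinear ((**) :: mat5 \<Rightarrow> mat5 \<Rightarrow> mat5)"
    unfolding bilinear_def
    by (auto intro!: linearI simp: matrix_matrix_mult_def vec_eq_iff algebra_simps sum.distrib sum_distrib_left)
  then show ?thesis by (simp add: bilinear_conv_bounded_bilinear)
qed

lemma linear_trace5: "bounded_linear (trace :: mat5 \<Rightarrow> real)"
proof -
  have "linear (trace :: mat5 \<Rightarrow> real)"
    by (auto intro!: linearI simp: trace_def sum.distrib sum_distrib_left)
  then show ?thesis by (simp add: linear_conv_bounded_linear)
qed

lemma has_asym_grad_I_inv: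
  assumes L: "L \<in> asym_mats"
  shows "has_asym_grad I_inv (- 24 *\<^sub>R (4 *\<^sub>R (L ** L ** L) + (L \<bullet> L) *\<^sub>R L)) L"
proof -
  note der = bounded_bilinear.FDERIV[OF bilinear_mat5]
  let ?d2 = "\<lambda>Y. L ** Y + Y ** L"
  let ?d3 = "\<lambda>Y. L ** L ** Y + ?d2 Y ** L"
  let ?d4 = "\<lambda>Y. L ** L ** L ** Y + ?d3 Y ** L"
  have d1: "((\<lambda>X. X) has_derivative (\<lambda>Y. Y)) (at L within asym_mats)" by simp
  have d2: "((\<lambda>X. X ** X) has_derivative ?d2) (at L within asym_mats)" using der[OF d1 d1] .
  have d3: "((\<lambda>X. X ** X ** X) has_derivative ?d3) (at L within asym_mats)" using der[OF d2 d1] .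
  have d4: "((\<lambda>X. X ** X ** X ** X) has_derivative ?d4) (at L within asym_mats)" using der[OF d3 d1] .
  note tr = bounded_linear.has_derivative[OF linear_trace5]
  have dI: "(I_inv has_derivative
      (\<lambda>Y. 6 * (4 * trace (?d4 Y) - 2 * trace (L ** L) * trace (?d2 Y)))) (at L within asym_mats)"
    unfolding I_inv_def
    by (rule has_derivative_eq_rhs[OF has_derivative_mult_right[OF has_derivative_diff[OF
          has_derivative_mult_right[OF tr[OF d4]] has_derivative_power[OF tr[OF d2], of 2]]]])
      (simp add: fun_eq_iff)
  have L3: "L ** L ** L \<in> asym_mats"
  proof -
    have t: "transpose L = - L" using L by (simp add: asym_mats_def)
    have mm: "A ** (- B) = - (A ** B)" "(- A) ** B = - (A ** B)" for A B :: mat5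
      by (auto simp: matrix_matrix_mult_def vec_eq_iff sum_negf)
    show ?thesis
      by (simp add: asym_mats_def matrix_transpose_mul t mm matrix_mul_assoc)
  qed
  have t2: "trace (?d2 Y) = - 2 * (L \<bullet> Y)" for Y
    by (simp add: trace_add trace_mul_sym[of Y L] trace_mult_asym[OF L])
  have "trace (?d4 Y) = 4 * trace (L ** L ** L ** Y)" for Y
  proof -
    have e: "(A + B) ** C = A ** C + B ** C" for A B C :: mat5
      by (rule bounded_bilinear.add_left[OF bilinear_mat5])
    have "trace (L ** L ** Y ** L) = trace (L ** L ** L ** Y)"
      by (subst trace_mul_sym) (simp add: matrix_mul_assoc)
    moreover have "trace (L ** Y ** L ** L) = trace (L ** L ** L ** Y)"
      using trace_mul_sym[of "L ** Y" "L ** L"] by (simp add: matrix_mul_assoc)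
    moreover have "trace (Y ** L ** L ** L) = trace (L ** L ** L ** Y)"
      using trace_mul_sym[of Y "L ** L ** L"] by (simp add: matrix_mul_assoc)
    ultimately show ?thesis by (simp add: e trace_add)
  qed
  then have t4: "trace (?d4 Y) = - 4 * ((L ** L ** L) \<bullet> Y)" for Y
    using trace_mult_asym[OF L3] by simp
  have "(\<lambda>Y. 6 * (4 * trace (?d4 Y) - 2 * trace (L ** L) * trace (?d2 Y))) =
      (\<lambda>Y. (- 24 *\<^sub>R (4 *\<^sub>R (L ** L ** L) + (L \<bullet> L) *\<^sub>R L)) \<bullet> Y)"
    unfolding t2 t4 trace_mult_asym[OF L] by (auto simp: inner_add_left inner_diff_left algebra_simps)
  with dI have "(I_inv has_derivative
      (\<lambda>Y. (- 24 *\<^sub>R (4 *\<^sub>R (L ** L ** L) + (L \<bullet> L) *\<^sub>R L)) \<bullet> Y)) (at L within asym_mats)" by simp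
  moreover have "- 24 *\<^sub>R (4 *\<^sub>R (L ** L ** L) + (L \<bullet> L) *\<^sub>R L) \<in> asym_mats"
    using L L3 subspace_asym_mats by (meson subspace_add subspace_mul)
  ultimately show ?thesis by (simp add: has_asym_grad_def)
qed

lemma asym_grad_I_inv:
  "L \<in> asym_mats \<Longrightarrow> asym_grad I_inv L = - 24 *\<^sub>R (4 *\<^sub>R (L ** L ** L) + (L \<bullet> L) *\<^sub>R L)"
  by (rule asym_grad_eq[OF has_asym_grad_I_inv])

end

theory Submission
  imports Defs
begin

text \<open>In a suitable orthonormal frame an antisymmetric matrix is
  \<open>x e\<^sub>1\<and>e\<^sub>2 + y e\<^sub>3\<and>e\<^sub>4\<close>, with \<open>s = (x\<^sup>2 + y\<^sup>2) / 2\<close>, \<open>p = \<bar>x y\<bar>\<close> and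
  \<open>I = 24 (x\<^sup>2 - y\<^sup>2)\<^sup>2\<close>, so \<open>I = 96 (s\<^sup>2 - p\<^sup>2)\<close>. The gradient of \<open>I\<close> has the same form, with
  coefficients proportional to \<open>x (y\<^sup>2 - x\<^sup>2)\<close> and \<open>y (x\<^sup>2 - y\<^sup>2)\<close>; it is therefore orthogonal to
  \<open>\<Lambda>\<close> for the contraction \<open>\<epsilon> \<Lambda> M\<close>, which is \<open>4 (x y' + y x')\<close> times a unit vector. As
  \<open>B + \<Lambda> = V' \<partial>I\<close>, the expression defining the Hamiltonian is stationary in \<open>\<Lambda>\<close>, which gives
  \<open>H = - B - 2 \<Lambda> = - \<Lambda> - V' \<partial>I\<close>, while \<open>B = - \<Lambda> + V' \<partial>I\<close>: the two \<open>\<epsilon>\<close>-squares differ by a multiple of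
  \<open>\<epsilon> \<Lambda> \<partial>I = 0\<close>.\<close>

section \<open>The Levi-Civita contraction as a determinant\<close>

lemma exhaust_5:
  fixes x :: 5
  shows "x = 1 \<or> x = 2 \<or> x = 3 \<or> x = 4 \<or> x = 5"
proof (induct x)
  case (of_int z)
  then have "z = 0 \<or> z = 1 \<or> z = 2 \<or> z = 3 \<or> z = 4" by fastforce
  then show ?case by auto
qed

lemma forall_5: "(\<forall>i::5. P i) \<longleftrightarrow> P 1 \<and> P 2 \<and> P 3 \<and> P 4 \<and> P 5"
  by (metis exhaust_5)

lemma UNIV_5: "(UNIV :: 5 set) = {1, 2, 3, 4, 5}"
  using exhaust_5 by auto

lemma sum_5: "(\<Sum>i\<in>(UNIV :: 5 set). f i) = f 1 + f 2 + f 3 + f 4 + (f 5 :: real)"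
  unfolding UNIV_5 by (simp add: add.assoc)

lemma prod_5: "(\<Prod>i\<in>(UNIV :: 5 set). f i) = f 1 * f 2 * f 3 * f 4 * (f 5 :: real)"
  unfolding UNIV_5 by (simp add: mult.assoc)

text \<open>This is the chain of updates inside \<open>levi_civita\<close>, named so that the symbol
  can be folded into it. The value type is general because tuples of indices and tuples of row
  vectors both occur.\<close>

definition tuple_fun :: "'a \<Rightarrow> 'a \<Rightarrow> 'a \<Rightarrow> 'a \<Rightarrow> 'a \<Rightarrow> 5 \<Rightarrow> 'a" where
  "tuple_fun u a b c d = (\<lambda>_. u)(2 := a, 3 := b, 4 := c, 5 := d)"

lemma tuple_fun_apply [simp]:
  "tuple_fun u a b c d 1 = u" "tuple_fun u a b c d 2 = a" "tuple_fun u a b c d 3 = b"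
  "tuple_fun u a b c d 4 = c" "tuple_fun u a b c d 5 = d"
  by (simp_all add: tuple_fun_def)

text \<open>A function on five points is the quintuple of its values. This turns the sum over
  functions behind a determinant into the nested index sums of \<open>eps_contr\<close>.\<close>

lemma sum_fun_5:
  fixes F :: "(5 \<Rightarrow> 'a::finite) \<Rightarrow> real"
  shows "(\<Sum>f\<in>UNIV. F f) =
    (\<Sum>i\<in>UNIV. \<Sum>j\<in>UNIV. \<Sum>k\<in>UNIV. \<Sum>l\<in>UNIV. \<Sum>m\<in>UNIV. F (tuple_fun i j k l m))"
proof -
  let ?t = "\<lambda>(i, j, k, l, m). tuple_fun i j k l m :: 5 \<Rightarrow> 'a"
  have "tuple_fun (f 1) (f 2) (f 3) (f 4) (f 5) = f" for f :: "5 \<Rightarrow> 'a"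
    unfolding fun_eq_iff forall_5 by simp
  then have "surj ?t"
    by (intro surjI[where f = "\<lambda>f. (f 1, f 2, f 3, f 4, f 5)"]) (simp only: split_conv)
  moreover have "inj ?t"
    by (rule inj_on_inverseI[where g = "\<lambda>f. (f 1, f 2, f 3, f 4, f 5)"]) (simp add: split_def)
  ultimately have "bij_betw ?t (UNIV \<times> UNIV \<times> UNIV \<times> UNIV \<times> UNIV) UNIV"
    by (simp add: bij_def)
  from sum.reindex_bij_betw[OF this, of F] show ?thesis
    by (simp add: sum.cartesian_product split_def del: UNIV_Times_UNIV)
qed

section \<open>Contractions of simple bivectors\<close>

definition outer_prod :: "real ^ 'n \<Rightarrow> real ^ 'm \<Rightarrow> real ^ 'm ^ 'n" where
  "outer_prod a b = (\<chi> i j. a $ i * b $ j)"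

definition wedge :: "real ^ 'n \<Rightarrow> real ^ 'n \<Rightarrow> real ^ 'n ^ 'n" where
  "wedge a b = outer_prod a b - outer_prod b a"

definition rows5 :: "real ^ 5 \<Rightarrow> real ^ 5 \<Rightarrow> real ^ 5 \<Rightarrow> real ^ 5 \<Rightarrow> real ^ 5 \<Rightarrow> mat5" where
  "rows5 u a b c d = (\<chi> i. tuple_fun u a b c d i)"

text \<open>This is the Leibniz formula: the symbol vanishes off the permutations, so the sum over
  permutations extends to all index tuples. Identities for \<open>eps_contr\<close> thereby reduce
  to row operations on determinants.\<close>

lemma inner_eps_contr_outer_prod:
  "u \<bullet> eps_contr (outer_prod a b) (outer_prod c d) = det (rows5 u a b c d)"
proof -
  define G :: "(5 \<Rightarrow> 5) \<Rightarrow> real" where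
    "G f = (if bij f then of_int (sign f) else 0) * (\<Prod>r\<in>UNIV. rows5 u a b c d $ r $ f r)" for f
  have "det (rows5 u a b c d) = (\<Sum>f\<in>{f. f permutes UNIV}. G f)"
    by (auto simp: det_def G_def permutes_bij intro!: sum.cong)
  also have "\<dots> = (\<Sum>f\<in>UNIV. G f)"
    by (rule sum.mono_neutral_left) (auto simp: G_def permutes_def bij_iff)
  also have "\<dots> = u \<bullet> eps_contr (outer_prod a b) (outer_prod c d)"
    unfolding sum_fun_5
    by (simp add: inner_vec_def eps_contr_def G_def levi_civita_def Let_def outer_prod_def
        sum_distrib_left prod_5 rows5_def mult_ac flip: tuple_fun_def)
  finally show ?thesis by simp
qed

lemma bounded_bilinear_eps_contr: "bounded_bilinear eps_contr"
proof -
  have eq: "eps_contr X Y $ i =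
      (\<Sum>(j, k, l, m)\<in>UNIV. levi_civita i j k l m * X $ j $ k * Y $ l $ m)" for X Y i
    by (simp add: eps_contr_def sum.cartesian_product flip: UNIV_Times_UNIV)
  have "bilinear eps_contr"
    unfolding bilinear_def
    by (auto intro!: linearI simp: eq vec_eq_iff split_def sum_distrib_left ring_distribs mult.assoc
        mult.left_commute simp flip: sum.distrib)
  then show ?thesis by (simp add: bilinear_conv_bounded_bilinear)
qed

lemma det_rows5_eq_0:
  "det (rows5 a a b c d) = 0" "det (rows5 a b a c d) = 0" "det (rows5 a b c a d) = 0"
  "det (rows5 a b c d a) = 0" "det (rows5 b a a c d) = 0" "det (rows5 b a c a d) = 0"
  "det (rows5 b a c d a) = 0" "det (rows5 b c a a d) = 0" "det (rows5 b c a d a) = 0"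
  "det (rows5 b c d a a) = 0"
proof -
  have *: "det (rows5 v a b c d) = 0"
    if "tuple_fun v a b c d i = tuple_fun v a b c d j" "i \<noteq> j" for v a b c d i j
    using that(1) by (intro det_identical_rows[OF that(2)]) (simp add: rows5_def row_def)
  show "det (rows5 a a b c d) = 0" by (rule *[of _ _ _ _ _ 1 2]) simp_all
  show "det (rows5 a b a c d) = 0" by (rule *[of _ _ _ _ _ 1 3]) simp_all
  show "det (rows5 a b c a d) = 0" by (rule *[of _ _ _ _ _ 1 4]) simp_all
  show "det (rows5 a b c d a) = 0" by (rule *[of _ _ _ _ _ 1 5]) simp_all
  show "det (rows5 b a a c d) = 0" by (rule *[of _ _ _ _ _ 2 3]) simp_all
  show "det (rows5 b a c a d) = 0" by (rule *[of _ _ _ _ _ 2 4]) simp_all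
  show "det (rows5 b a c d a) = 0" by (rule *[of _ _ _ _ _ 2 5]) simp_all
  show "det (rows5 b c a a d) = 0" by (rule *[of _ _ _ _ _ 3 4]) simp_all
  show "det (rows5 b c a d a) = 0" by (rule *[of _ _ _ _ _ 3 5]) simp_all
  show "det (rows5 b c d a a) = 0" by (rule *[of _ _ _ _ _ 4 5]) simp_all
qed

lemma det_rows5_swap:
  "det (rows5 u b a c d) = - det (rows5 u a b c d)"
  "det (rows5 u a c b d) = - det (rows5 u a b c d)"
  "det (rows5 u a b d c) = - det (rows5 u a b c d)"
proof -
  have *: "det ((\<chi> i. A $ Transposition.transpose k l i) :: mat5) = - det A" if "k \<noteq> l" for A :: mat5 and k l
    using det_permute_rows[OF permutes_swap_id[of k UNIV l], of A] that by (simp add: sign_swap_id)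
  have "rows5 u b a c d = (\<chi> i. rows5 u a b c d $ Transposition.transpose 2 3 i)"
    "rows5 u a c b d = (\<chi> i. rows5 u a b c d $ Transposition.transpose 3 4 i)"
    "rows5 u a b d c = (\<chi> i. rows5 u a b c d $ Transposition.transpose 4 5 i)"
    \<comment> \<open>Extensionality is instantiated at the level of rows only, so that the row
      vectors are compared as wholes and not entry by entry.\<close>
    unfolding vec_eq_iff[where 'a="real^5" and 'b=5] forall_5[where P="\<lambda>i. _ $ i = _ $ i"]
    by (simp_all add: rows5_def Transposition.transpose_def)
  then show "det (rows5 u b a c d) = - det (rows5 u a b c d)"
    "det (rows5 u a c b d) = - det (rows5 u a b c d)"
    "det (rows5 u a b d c) = - det (rows5 u a b c d)"
    by (simp_all add: *)
qed

text \<open>Expanding both wedges gives four determinants. Each row swap brings a sign that cancels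
  the sign in the wedge, so all four terms agree.\<close>

lemma eps_contr_wedge_wedge:
  "eps_contr (wedge a b) (wedge c d) = 4 *\<^sub>R eps_contr (outer_prod a b) (outer_prod c d)"
proof -
  have "u \<bullet> eps_contr (wedge a b) (wedge c d) = u \<bullet> (4 *\<^sub>R eps_contr (outer_prod a b) (outer_prod c d))" for u
    by (simp add: det_rows5_swap(1)[of u b a] det_rows5_swap(3)[of u _ _ d c]
        wedge_def bounded_bilinear.diff_left[OF bounded_bilinear_eps_contr]
        bounded_bilinear.diff_right[OF bounded_bilinear_eps_contr] inner_diff_right
        inner_eps_contr_outer_prod)
  then show ?thesis by (metis vector_eq_ldot)
qed

lemma eps_contr_wedge_self: "eps_contr (wedge a b) (wedge a b) = 0"
proof -
  have "u \<bullet> eps_contr (outer_prod a b) (outer_prod a b) = 0" for u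
    by (simp add: inner_eps_contr_outer_prod det_rows5_eq_0)
  then show ?thesis by (metis eps_contr_wedge_wedge inner_eq_zero_iff scaleR_zero_right)
qed

text \<open>Moving one pair of rows past the other takes four adjacent swaps, an even
  permutation.\<close>

lemma eps_contr_outer_prod_commute:
  "eps_contr (outer_prod c d) (outer_prod a b) = eps_contr (outer_prod a b) (outer_prod c d)"
proof -
  have "det (rows5 u c d a b) = det (rows5 u a b c d)" for u
    using det_rows5_swap(2)[of u a c b d] det_rows5_swap(1)[of u c a b d]
      det_rows5_swap(3)[of u c a d b] det_rows5_swap(2)[of u c a b d]
      det_rows5_swap(3)[of u a c b d] det_rows5_swap(2)[of u c d a b] by simp
  then have "u \<bullet> eps_contr (outer_prod c d) (outer_prod a b) = u \<bullet> eps_contr (outer_prod a b) (outer_prod c d)" for u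
    by (simp add: inner_eps_contr_outer_prod)
  then show ?thesis by (metis vector_eq_ldot)
qed

section \<open>Canonical matrices and their Levi-Civita contraction\<close>

text \<open>The columns of \<open>E\<close> are the frame. For orthogonal \<open>E\<close> the fifth
  column, absent from the formula, lies in the kernel.\<close>

definition canon :: "mat5 \<Rightarrow> real \<Rightarrow> real \<Rightarrow> mat5" where
  "canon E x y = x *\<^sub>R wedge (column 1 E) (column 2 E) + y *\<^sub>R wedge (column 3 E) (column 4 E)"

text \<open>For orthogonal \<open>E\<close> this is the fifth column up to sign, written without
  choosing the orientation of the frame.\<close>

definition frame_normal :: "mat5 \<Rightarrow> real ^ 5" where
  "frame_normal E = eps_contr (outer_prod (column 1 E) (column 2 E)) (outer_prod (column 3 E) (column 4 E))"

text \<open>The contraction of a plane with itself vanishes, and the two cross terms are equal by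
  symmetry; the 4 comes from antisymmetrising both planes.\<close>

lemma eps_contr_canon:
  "eps_contr (canon E x y) (canon E x' y') = (4 * (x * y' + y * x')) *\<^sub>R frame_normal E"
  by (simp add: canon_def frame_normal_def eps_contr_wedge_self eps_contr_wedge_wedge
      eps_contr_outer_prod_commute[of "column 3 E" "column 4 E" "column 1 E" "column 2 E"] algebra_simps
      bounded_bilinear.add_left[OF bounded_bilinear_eps_contr]
      bounded_bilinear.add_right[OF bounded_bilinear_eps_contr]
      bounded_bilinear.scaleR_left[OF bounded_bilinear_eps_contr]
      bounded_bilinear.scaleR_right[OF bounded_bilinear_eps_contr])

lemma eps_contr_canon_self: "eps_contr (canon E x y) (canon E x y) = (8 * (x * y)) *\<^sub>R frame_normal E"
  by (simp add: eps_contr_canon mult.commute)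

text \<open>The vector is expanded in the frame. Its components along the first four columns are
  determinants with a repeated row; the one along the fifth is the determinant of an orthogonal
  matrix, hence 1 or -1.\<close>

lemma norm_frame_normal:
  assumes "orthogonal_matrix E"
  shows "norm (frame_normal E) = 1"
proof -
  let ?c = "\<lambda>i. column i E" and ?w = "frame_normal E"
  let ?R = "rows5 (?c 5) (?c 1) (?c 2) (?c 3) (?c 4)"
  have E: "norm (?c i) = 1" "i \<noteq> j \<Longrightarrow> orthogonal (?c i) (?c j)" for i j
    using assms by (auto simp: orthogonal_matrix_orthonormal_columns)
  have "orthogonal_matrix ?R"
    unfolding orthogonal_matrix_orthonormal_rows forall_5
    by (simp add: rows5_def row_def E)
  then have "det ?R = 1 \<or> det ?R = -1" by (rule det_orthogonal_matrix)
  then have 5: "(?c 5 \<bullet> ?w)\<^sup>2 = 1"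
    by (auto simp: frame_normal_def inner_eps_contr_outer_prod)
  have 0: "?c 1 \<bullet> ?w = 0" "?c 2 \<bullet> ?w = 0" "?c 3 \<bullet> ?w = 0" "?c 4 \<bullet> ?w = 0"
    by (simp_all add: frame_normal_def inner_eps_contr_outer_prod det_rows5_eq_0)
  have "?w \<bullet> ?w = ?w \<bullet> (E *v (transpose E *v ?w))"
    using assms by (simp only: matrix_vector_mul_assoc orthogonal_matrix_def matrix_vector_mul_lid)
  also have "\<dots> = (transpose E *v ?w) \<bullet> (transpose E *v ?w)"
    by (simp add: flip: dot_lmul_matrix)
  also have "\<dots> = (\<Sum>i\<in>UNIV. (?c i \<bullet> ?w)\<^sup>2)"
    by (simp add: inner_vec_def[of "_ *v _"] matrix_vector_mul_component row_def column_def transpose_def power2_eq_square del: transpose_matrix_vector)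
  also have "\<dots> = 1" by (simp add: sum_5 0 5)
  finally show ?thesis by (simp add: norm_eq_sqrt_inner)
qed

section \<open>Conjugation by orthogonal matrices\<close>

lemma mat_conj_mult:
  fixes R X Y :: mat5
  assumes "orthogonal_matrix R"
  shows "(R ** X ** transpose R) ** (R ** Y ** transpose R) = R ** (X ** Y) ** transpose R"
proof -
  have "(R ** X ** transpose R) ** (R ** Y ** transpose R) = R ** X ** (transpose R ** R) ** Y ** transpose R"
    by (simp only: matrix_mul_assoc)
  with assms show ?thesis by (simp add: orthogonal_matrix_def matrix_mul_assoc)
qed

lemma trace_conj:
  fixes R X :: mat5
  assumes "orthogonal_matrix R"
  shows "trace (R ** X ** transpose R) = trace X"
  using assms trace_mul_sym[of "R ** X" "transpose R"]
  by (simp add: matrix_mul_assoc orthogonal_matrix_def)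

lemma inner_eq_trace: "X \<bullet> Y = trace (transpose X ** Y)" for X Y :: mat5
  by (simp add: inner_vec_def trace_def matrix_matrix_mult_def transpose_def) (rule sum.swap)

lemma inner_conj:
  fixes R X Y :: mat5
  assumes "orthogonal_matrix R"
  shows "(R ** X ** transpose R) \<bullet> (R ** Y ** transpose R) = X \<bullet> Y"
proof -
  have "transpose (R ** X ** transpose R) = R ** transpose X ** transpose R"
    by (simp add: matrix_transpose_mul matrix_mul_assoc)
  then show ?thesis
    by (simp only: inner_eq_trace mat_conj_mult[OF assms] trace_conj[OF assms])
qed

lemma I_inv_conj: "orthogonal_matrix R \<Longrightarrow> I_inv (R ** X ** transpose R) = I_inv X"
  by (simp add: I_inv_def mat_conj_mult trace_conj)

lemma asym_mats_conj: "X \<in> asym_mats \<Longrightarrow> R ** X ** transpose R \<in> asym_mats"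
  by (simp add: asym_mats_def matrix_transpose_mul matrix_mul_assoc
      bounded_bilinear.minus_left[OF bilinear_mat5] bounded_bilinear.minus_right[OF bilinear_mat5])

text \<open>The explicit gradient of \<open>I_inv\<close> is built from matrix products and the full
  contraction, both compatible with conjugation, so no derivative has to be transported.\<close>

lemma B_map_conj:
  assumes R: "orthogonal_matrix R" and L: "L \<in> asym_mats"
  shows "B_map V (R ** L ** transpose R) = R ** B_map V L ** transpose R"
proof -
  note bil = bounded_bilinear.add_left[OF bilinear_mat5] bounded_bilinear.add_right[OF bilinear_mat5]
    bounded_bilinear.scaleR_left[OF bilinear_mat5] bounded_bilinear.scaleR_right[OF bilinear_mat5]
    bounded_bilinear.minus_left[OF bilinear_mat5] bounded_bilinear.minus_right[OF bilinear_mat5]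
  show ?thesis
    unfolding B_map_def asym_grad_I_inv[OF L] asym_grad_I_inv[OF asym_mats_conj[OF L]]
      mat_conj_mult[OF R] inner_conj[OF R] I_inv_conj[OF R]
    by (simp only: bil)
qed

section \<open>Algebra and invariants of canonical matrices\<close>

lemma wedge_asym: "wedge a b \<in> asym_mats"
  by (simp add: wedge_def outer_prod_def asym_mats_def transpose_def vec_eq_iff)

lemma canon_asym: "canon E x y \<in> asym_mats"
  unfolding canon_def by (intro subspace_add subspace_mul subspace_asym_mats wedge_asym)

lemma outer_prod_vector: "outer_prod a b *v v = (b \<bullet> v) *\<^sub>R a"
  by (simp add: outer_prod_def matrix_vector_mult_def inner_vec_def vec_eq_iff sum_distrib_left mult_ac)

lemma canon_vector:
  "canon E x y *v v = x *\<^sub>R ((column 2 E \<bullet> v) *\<^sub>R column 1 E - (column 1 E \<bullet> v) *\<^sub>R column 2 E)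
     + y *\<^sub>R ((column 4 E \<bullet> v) *\<^sub>R column 3 E - (column 3 E \<bullet> v) *\<^sub>R column 4 E)"
  by (simp add: canon_def wedge_def matrix_vector_mult_add_rdistrib matrix_vector_mult_diff_rdistrib
      outer_prod_vector scaleR_matrix_vector_assoc[symmetric])

lemma orthonormal_columns:
  fixes E :: "real ^ 'n ^ 'n"
  assumes "orthogonal_matrix E"
  shows "column i E \<bullet> column j E = (if i = j then 1 else 0)"
  using assms by (simp add: orthogonal_matrix_orthonormal_columns norm_eq_1 orthogonal_def)

text \<open>An orthogonal factor can be cancelled. Matrix identities are thus checked on the five
  frame vectors.\<close>

lemma mat_eqI_columns:
  fixes A B E :: mat5
  assumes "orthogonal_matrix E" and "\<And>j. A *v column j E = B *v column j E"
  shows "A = B"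
proof -
  have "column j (A ** E) = column j (B ** E)" for j
    using assms(2)[of j] by (metis matrix_vector_mul_assoc matrix_vector_mult_basis)
  then have "A ** E = B ** E" by (simp add: vec_eq_iff column_def)
  then have "A ** (E ** transpose E) = B ** (E ** transpose E)" by (simp only: matrix_mul_assoc)
  with assms(1) show ?thesis by (simp add: orthogonal_matrix_def)
qed

lemma canon_columns:
  assumes "orthogonal_matrix E"
  shows "canon E x y *v column 1 E = - x *\<^sub>R column 2 E" "canon E x y *v column 2 E = x *\<^sub>R column 1 E"
    "canon E x y *v column 3 E = - y *\<^sub>R column 4 E" "canon E x y *v column 4 E = y *\<^sub>R column 3 E"
    "canon E x y *v column 5 E = 0"
  by (simp_all add: canon_vector orthonormal_columns[OF assms])

text \<open>On its two planes the matrix squares to \<open>- (x\<^sup>2)\<close> and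
  \<open>- (y\<^sup>2)\<close>, so cubing stays within the canonical matrices of the same
  frame.\<close>

lemma canon_cube:
  assumes "orthogonal_matrix E"
  shows "canon E x y ** canon E x y ** canon E x y = canon E (- (x ^ 3)) (- (y ^ 3))"
proof (rule mat_eqI_columns[OF assms])
  have "\<forall>j. (canon E x y ** canon E x y ** canon E x y) *v column j E = canon E (- (x ^ 3)) (- (y ^ 3)) *v column j E"
    unfolding forall_5
    by (simp add: canon_columns[OF assms] matrix_vector_mult_scaleR power3_eq_cube mult.assoc
        linear_neg[OF matrix_vector_mul_linear]
      flip: matrix_vector_mul_assoc)
  then show "(canon E x y ** canon E x y ** canon E x y) *v column j E = canon E (- (x ^ 3)) (- (y ^ 3)) *v column j E" for j ..
qed

lemma inner_outer_prod: "outer_prod a b \<bullet> outer_prod c d = (a \<bullet> c) * (b \<bullet> d)"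
  by (simp add: outer_prod_def inner_vec_def sum_product mult_ac) (rule sum.swap)

lemma inner_canon:
  assumes "orthogonal_matrix E"
  shows "canon E x y \<bullet> canon E x' y' = 2 * (x * x' + y * y')"
  by (simp add: canon_def wedge_def inner_outer_prod inner_add_left inner_add_right inner_diff_left
      inner_diff_right orthonormal_columns[OF assms])

lemma s_inv_canon: "orthogonal_matrix E \<Longrightarrow> s_inv (canon E x y) = (x\<^sup>2 + y\<^sup>2) / 2"
  by (simp add: s_inv_def inner_canon power2_eq_square)

lemma p_inv_canon:
  assumes "orthogonal_matrix E"
  shows "p_inv (canon E x y) = \<bar>x * y\<bar>"
proof -
  have "p_vec (canon E x y) = (x * y) *\<^sub>R frame_normal E"
    by (simp add: p_vec_def eps_contr_canon)
  then show ?thesis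
    using norm_frame_normal[OF assms] by (simp only: p_inv_def norm_scaleR flip: norm_eq_sqrt_inner)
qed

text \<open>Writing the fourth power as the matrix times its cube makes both traces contractions of
  canonical matrices.\<close>

lemma I_inv_canon:
  assumes "orthogonal_matrix E"
  shows "I_inv (canon E x y) = 24 * (x\<^sup>2 - y\<^sup>2)\<^sup>2"
proof -
  let ?L = "canon E x y"
  have "trace (?L ** ?L ** ?L ** ?L) = trace (?L ** (?L ** ?L ** ?L))" by (simp add: matrix_mul_assoc)
  then have "I_inv ?L = 6 * (- 4 * (?L \<bullet> canon E (- (x ^ 3)) (- (y ^ 3))) - (?L \<bullet> ?L)\<^sup>2)"
    by (simp add: I_inv_def trace_mult_asym[OF canon_asym] canon_cube[OF assms])
  then show ?thesis by (simp add: inner_canon[OF assms] power2_eq_square power3_eq_cube algebra_simps)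
qed

lemma canon_conj: "R ** canon E x y ** transpose R = canon (R ** E) x y"
proof -
  have c: "R *v column i E = column i (R ** E)" for i
    by (metis matrix_vector_mul_assoc matrix_vector_mult_basis)
  have "R ** outer_prod a b ** transpose R = outer_prod (R *v a) (R *v b)" for a b
    by (simp add: outer_prod_def matrix_matrix_mult_def matrix_vector_mult_def transpose_def vec_eq_iff
        sum_distrib_left sum_distrib_right mult_ac)
  then show ?thesis
    by (simp add: canon_def wedge_def c bounded_bilinear.add_left[OF bilinear_mat5]
        bounded_bilinear.add_right[OF bilinear_mat5] bounded_bilinear.diff_left[OF bilinear_mat5]
        bounded_bilinear.diff_right[OF bilinear_mat5] bounded_bilinear.scaleR_left[OF bilinear_mat5]
        bounded_bilinear.scaleR_right[OF bilinear_mat5])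
qed

section \<open>The canonical form of an antisymmetric matrix\<close>

lemma inner_asym:
  assumes "B \<in> asym_mats"
  shows "u \<bullet> (B *v v) = - ((B *v u) \<bullet> v)"
proof -
  have B: "transpose B = - B" using assms by (simp add: asym_mats_def)
  have "u \<bullet> (B *v v) = (u v* B) \<bullet> v" by (simp add: dot_lmul_matrix)
  also have "u v* B = - (B *v u)"
    by (metis B diff_0 matrix_vector_mult_0 matrix_vector_mult_diff_rdistrib transpose_matrix_vector)
  finally show ?thesis by simp
qed

text \<open>Variational argument: \<open>e\<close> maximises the length of \<open>B *v v\<close> on
  the unit sphere of \<open>S\<close>, and \<open>f\<close> is the direction of its image. The norm
  bound is kept in the conclusion because it later orders the two coefficients.\<close>

lemma asym_orthonormal_pair:
  assumes B: "B \<in> asym_mats" and S: "subspace S" and dim: "dim S \<ge> 2"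
    and inv: "\<And>v. v \<in> S \<Longrightarrow> B *v v \<in> S"
  obtains e f l where "e \<in> S" "f \<in> S" "norm e = 1" "norm f = 1" "e \<bullet> f = 0" "l \<ge> 0"
    "B *v e = - l *\<^sub>R f" "B *v f = l *\<^sub>R e" "\<And>v. v \<in> S \<Longrightarrow> norm (B *v v) \<le> l * norm v"
proof -
  obtain C where C: "C \<subseteq> S" "pairwise orthogonal C" "\<And>x. x \<in> C \<Longrightarrow> norm x = 1" "card C = dim S"
    using orthonormal_basis_subspace[OF S] by metis
  obtain c d where cd: "c \<in> C" "d \<in> C" "c \<noteq> d"
    using dim C(4) by (metis card_2_iff' card_le_Suc0_iff_eq card.infinite not_less_eq_eq numeral_2_eq_2 zero_neq_numeral le_zero_eq)
  have cd': "c \<in> S" "d \<in> S" "norm c = 1" "norm d = 1" "c \<bullet> d = 0"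
    using C cd by (auto simp: pairwise_def orthogonal_def)
  have "compact (sphere 0 1 \<inter> S)" "sphere 0 1 \<inter> S \<noteq> {}"
    using cd' closed_subspace[OF S] by (auto intro: compact_Int_closed)
  moreover have "continuous_on (sphere 0 1 \<inter> S) (\<lambda>v. norm (B *v v))"
    by (intro continuous_on_norm linear_continuous_on matrix_vector_mul_bounded_linear)
  ultimately obtain e where e: "e \<in> sphere 0 1 \<inter> S"
    and max: "\<And>v. v \<in> sphere 0 1 \<inter> S \<Longrightarrow> norm (B *v v) \<le> norm (B *v e)"
    using continuous_attains_sup[of "sphere 0 1 \<inter> S" "\<lambda>v. norm (B *v v)"] by blast
  define l where "l = norm (B *v e)"
  have bound: "norm (B *v v) \<le> l * norm v" if "v \<in> S" for v
  proof (cases "v = 0")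
    case False
    then have "norm (B *v (inverse (norm v) *\<^sub>R v)) \<le> l"
      unfolding l_def using that S by (intro max) (auto intro: subspace_mul)
    with False show ?thesis by (simp add: matrix_vector_mult_scaleR field_simps)
  qed simp
  show ?thesis
  proof (cases "l = 0")
    \<comment> \<open>If the maximum is 0, \<open>B\<close> vanishes on \<open>S\<close> and the
      orthonormal pair \<open>c\<close>, \<open>d\<close> serves.\<close>
    case True
    then have "B *v v = 0" if "v \<in> S" for v using bound[OF that] by simp
    with that[of c d 0] cd' show ?thesis by simp
  next
    case False
    \<comment> \<open>The sign makes \<open>e\<close>, \<open>f\<close> turn in the same sense as
      the first two columns of the frame under \<open>canon\<close>.\<close>
    define f where "f = (- inverse l) *\<^sub>R (B *v e)"
    have e': "e \<in> S" "norm e = 1" using e by auto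
    have l: "l > 0" using False by (simp add: l_def)
    have f: "f \<in> S" "norm f = 1" using e' l S inv by (auto simp: f_def l_def intro!: subspace_mul subspace_neg)
    have Be: "B *v e = - l *\<^sub>R f" using l by (simp add: f_def)
    have "e \<bullet> (B *v e) = 0" using inner_asym[OF B, of e e] by (simp add: inner_commute)
    with Be l have ef: "e \<bullet> f = 0" by simp
    have "e \<bullet> (B *v f) = l"
      using inner_asym[OF B, of e f] f(2) by (simp add: Be flip: power2_norm_eq_inner)
    moreover have "(norm (B *v f))\<^sup>2 \<le> l\<^sup>2" using bound[OF f(1)] f(2) by (simp add: power_mono)
    \<comment> \<open>the equality case of Cauchy-Schwarz forces \<open>B f = l e\<close>, since \<open>l\<close> is the maximal stretching factor\<close>
    moreover have "(norm (B *v f - l *\<^sub>R e))\<^sup>2 = (norm (B *v f))\<^sup>2 - 2 * l * (e \<bullet> (B *v f)) + l\<^sup>2 * (norm e)\<^sup>2"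
      by (simp only: power2_norm_eq_inner) (simp add: inner_diff_left inner_diff_right inner_commute power2_eq_square)
    ultimately have "(norm (B *v f - l *\<^sub>R e))\<^sup>2 \<le> 0" using e'(2) by (simp add: power2_eq_square)
    then have "B *v f = l *\<^sub>R e" by simp
    with that[of e f l] e' f l ef Be bound show ?thesis by simp
  qed
qed

text \<open>The pair lemma is applied to the whole space and then to the orthogonal complement of
  the first plane, which is invariant by skew-symmetry. A unit vector orthogonal to both planes
  completes the frame.\<close>

lemma canonical_form:
  assumes B: "B \<in> asym_mats"
  obtains E x y where "orthogonal_matrix E" "0 \<le> y" "y \<le> x" "B = canon E x y"
proof -
  obtain e f x where ef: "norm e = 1" "norm f = 1" "e \<bullet> f = 0" "x \<ge> 0"
    "B *v e = - x *\<^sub>R f" "B *v f = x *\<^sub>R e" and bound: "\<And>v. norm (B *v v) \<le> x * norm v"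
    using asym_orthonormal_pair[OF B subspace_UNIV] by (auto simp: dim_UNIV)
  let ?S = "{v \<in> UNIV. \<forall>u\<in>span {e, f}. orthogonal u v}"
  have S: "subspace ?S" by (auto simp: subspace_def orthogonal_def inner_add_right)
  have memS: "v \<in> ?S \<longleftrightarrow> e \<bullet> v = 0 \<and> f \<bullet> v = 0" for v
  proof -
    have "v \<in> ?S" if "e \<bullet> v = 0" "f \<bullet> v = 0"
    proof -
      have "orthogonal v u" if "u \<in> span {e, f}" for u
        using that by (rule orthogonal_to_span) (use \<open>e \<bullet> v = 0\<close> \<open>f \<bullet> v = 0\<close> in \<open>auto simp: orthogonal_def inner_commute\<close>)
      then show ?thesis by (simp add: orthogonal_commute)
    qed
    then show ?thesis by (auto simp: orthogonal_def span_base)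
  qed
  have "dim ?S + dim (span {e, f}) = 5"
    by (subst dim_subspace_orthogonal_to_vectors) (auto simp: dim_UNIV)
  moreover have "dim (span {e, f}) \<le> 2"
    using dim_le_card'[of "{e, f}"] card_length[of "[e, f]"] by (simp add: dim_span)
  ultimately have dim: "dim ?S \<ge> 2" by linarith
  have inv: "B *v v \<in> ?S" if "v \<in> ?S" for v
    using that ef inner_asym[OF B, of e v] inner_asym[OF B, of f v] unfolding memS by simp
  obtain g h y where gh: "g \<in> ?S" "h \<in> ?S" "norm g = 1" "norm h = 1" "g \<bullet> h = 0" "y \<ge> 0"
    "B *v g = - y *\<^sub>R h" "B *v h = y *\<^sub>R g"
    by (rule asym_orthonormal_pair[OF B S dim inv]) blast+
  \<comment> \<open>The factor \<open>x\<close> bounds the stretching on the whole space, in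
    particular on the second plane.\<close>
  have "y \<le> x" using bound[of h] gh by simp
  have "dim {e, f, g, h} \<le> card {e, f, g, h}" by (rule dim_le_card') simp
  also have "\<dots> \<le> 4" using card_length[of "[e, f, g, h]"] by simp
  finally obtain k0 where k0: "k0 \<noteq> 0" "\<And>u. u \<in> span {e, f, g, h} \<Longrightarrow> orthogonal k0 u"
    using orthogonal_to_subspace_exists[of "{e, f, g, h}"] by (auto simp: orthogonal_commute)
  define k where "k = inverse (norm k0) *\<^sub>R k0"
  have k: "norm k = 1" "e \<bullet> k = 0" "f \<bullet> k = 0" "g \<bullet> k = 0" "h \<bullet> k = 0"
    using k0 by (auto simp: k_def orthogonal_def inner_commute span_base)
  note gh' = gh(1,2)[unfolded memS]
  define E :: mat5 where "E = transpose (rows5 e f g h k)"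
  have col: "column 1 E = e" "column 2 E = f" "column 3 E = g" "column 4 E = h" "column 5 E = k"
    by (simp_all add: E_def) (simp_all add: row_def rows5_def)
  have E: "orthogonal_matrix E"
    unfolding orthogonal_matrix_orthonormal_columns forall_5 col
    using ef gh gh' k by (simp add: orthogonal_def inner_commute)
  \<comment> \<open>\<open>B *v k\<close> is orthogonal to both planes because they are invariant,
    and to \<open>k\<close> by skew-symmetry; so it vanishes.\<close>
  have "w \<bullet> (B *v k) = 0" if "w \<in> {e, f, g, h, k}" for w
  proof -
    have "k \<bullet> (B *v k) = 0" using inner_asym[OF B, of k k] by (simp add: inner_commute)
    then show ?thesis
      using that k ef gh by (auto simp: inner_asym[OF B, of _ k])
  qed
  then have "column j E \<bullet> (B *v k) = 0" for j
    using exhaust_5[of j] col by auto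
  then have "transpose E *v (B *v k) = 0"
    by (simp only: matrix_mult_dot) (simp add: vec_eq_iff column_def transpose_def)
  then have "E *v (transpose E *v (B *v k)) = 0" by simp
  then have Bk: "B *v k = 0"
    using E by (simp only: matrix_vector_mul_assoc[of E] orthogonal_matrix_def matrix_vector_mul_lid)
  have "\<forall>j. B *v column j E = canon E x y *v column j E"
    unfolding forall_5 canon_columns[OF E] unfolding col using ef gh Bk by simp
  then have "B = canon E x y" using mat_eqI_columns[OF E] by blast
  with that E \<open>y \<ge> 0\<close> \<open>y \<le> x\<close> show ?thesis by blast
qed

section \<open>The invariants and the orbits\<close>

text \<open>The relation \<open>I = 96 (s\<^sup>2 - p\<^sup>2)\<close> is solved for
  \<open>p\<close>, so that its derivative follows from those of the polynomials
  \<open>s_inv\<close> and \<open>I_inv\<close>.\<close>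

lemma p_inv_eq_sqrt:
  assumes "B \<in> asym_mats"
  shows "p_inv B = sqrt ((s_inv B)\<^sup>2 - I_inv B / 96)"
proof -
  obtain E x y where E: "orthogonal_matrix E" "B = canon E x y" using canonical_form[OF assms] by metis
  have "(s_inv B)\<^sup>2 - I_inv B / 96 = (x * y)\<^sup>2"
    by (simp add: E s_inv_canon I_inv_canon power2_eq_square) (simp add: field_simps)
  then show ?thesis by (simp add: E p_inv_canon)
qed

text \<open>Since \<open>2 (s + p) = (x + y)\<^sup>2\<close> and
  \<open>2 (s - p) = (x - y)\<^sup>2\<close>, the ordered nonnegative coefficients are determined by
  the invariants. The required \<open>R\<close> carries one frame to the other.\<close>

lemma same_invariants_conj:
  assumes B: "B \<in> asym_mats" and B': "B' \<in> asym_mats"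
    and s: "s_inv B = s_inv B'" and p: "p_inv B = p_inv B'"
  obtains R where "orthogonal_matrix R" "B' = R ** B ** transpose R"
proof -
  obtain E x y where E: "orthogonal_matrix E" "0 \<le> y" "y \<le> x" "B = canon E x y"
    using canonical_form[OF B] by metis
  obtain E' x' y' where E': "orthogonal_matrix E'" "0 \<le> y'" "y' \<le> x'" "B' = canon E' x' y'"
    using canonical_form[OF B'] by metis
  have 1: "x\<^sup>2 + y\<^sup>2 = x'\<^sup>2 + y'\<^sup>2" and 2: "x * y = x' * y'"
    using s p E E' by (simp_all add: s_inv_canon p_inv_canon)
  have "(x + y)\<^sup>2 = (x' + y')\<^sup>2" "(x - y)\<^sup>2 = (x' - y')\<^sup>2"
    using 1 2 by (simp_all add: power2_sum power2_diff)
  then have "x + y = x' + y'" "x - y = x' - y'"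
    using E E' by (simp_all add: power2_eq_iff_nonneg)
  then have xy: "x' = x" "y' = y" by simp_all
  let ?R = "E' ** transpose E"
  have "?R ** E = E'"
    using E(1) by (simp add: orthogonal_matrix_def flip: matrix_mul_assoc)
  then have "B' = ?R ** B ** transpose ?R"
    by (simp add: E(4) E'(4) canon_conj xy)
  moreover have "orthogonal_matrix ?R"
    using E(1) E'(1) by (simp add: orthogonal_matrix_mul orthogonal_matrix_transpose)
  ultimately show ?thesis using that by blast
qed

section \<open>Functions of the two invariants\<close>

lemma has_asym_grad_s_inv:
  assumes "B \<in> asym_mats"
  shows "has_asym_grad s_inv ((1/2) *\<^sub>R B) B"
proof -
  have "(s_inv has_derivative (\<lambda>Y. ((1/2) *\<^sub>R B) \<bullet> Y)) (at B within asym_mats)"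
    unfolding s_inv_def by (auto intro!: derivative_eq_intros simp: inner_commute)
  with assms show ?thesis by (simp add: has_asym_grad_def subspace_mul[OF subspace_asym_mats])
qed

text \<open>The chain rule is applied to the square root, which is differentiable as
  \<open>p\<close> is positive. The terms from \<open>s\<^sup>2\<close> and from
  \<open>(B \<bullet> B) *\<^sub>R B\<close> both contribute \<open>s\<close>, whence the factor
  2.\<close>

lemma has_asym_grad_p_inv:
  assumes B: "B \<in> asym_mats" and p: "p_inv B > 0"
  shows "has_asym_grad p_inv ((1 / (2 * p_inv B)) *\<^sub>R ((2 * s_inv B) *\<^sub>R B + B ** B ** B)) B"
proof -
  let ?I = "- 24 *\<^sub>R (4 *\<^sub>R (B ** B ** B) + (B \<bullet> B) *\<^sub>R B)"
  let ?G = "(1 / (2 * p_inv B)) *\<^sub>R ((2 * s_inv B) *\<^sub>R B + B ** B ** B)"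
  let ?q = "(s_inv B)\<^sup>2 - I_inv B / 96"
  have q: "?q > 0" "p_inv B = sqrt ?q" using p p_inv_eq_sqrt[OF B] by auto
  have ds: "(s_inv has_derivative (\<lambda>Y. ((1/2) *\<^sub>R B) \<bullet> Y)) (at B within asym_mats)"
    using has_asym_grad_s_inv[OF B] by (simp only: has_asym_grad_def)
  have dI: "?I \<in> asym_mats" "(I_inv has_derivative (\<lambda>Y. ?I \<bullet> Y)) (at B within asym_mats)"
    using has_asym_grad_I_inv[OF B] by (simp_all only: has_asym_grad_def)
  have "((\<lambda>X. sqrt ((s_inv X)\<^sup>2 - I_inv X / 96)) has_derivative
      (\<lambda>Y. (2 * s_inv B * (((1/2) *\<^sub>R B) \<bullet> Y) - (?I \<bullet> Y) / 96) * (inverse (sqrt ?q) / 2))) (at B within asym_mats)"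
    by (rule has_derivative_eq_rhs,
        rule has_derivative_real_sqrt[where g = "\<lambda>X. (s_inv X)\<^sup>2 - I_inv X / 96", OF q(1)
          has_derivative_diff[OF has_derivative_power[OF ds]
            bounded_linear.has_derivative[OF bounded_linear_divide dI(2)]]])
      (simp add: mult.commute)
  also have "(\<lambda>Y. (2 * s_inv B * (((1/2) *\<^sub>R B) \<bullet> Y) - (?I \<bullet> Y) / 96) * (inverse (sqrt ?q) / 2)) = (\<lambda>Y. ?G \<bullet> Y)"
    unfolding q(2)[symmetric] using p by (auto simp: s_inv_def inner_add_left inner_diff_left field_simps)
  finally have "(p_inv has_derivative (\<lambda>Y. ?G \<bullet> Y)) (at B within asym_mats)"
    by (rule has_derivative_transform[OF B p_inv_eq_sqrt, rotated])
  moreover have "?G \<in> asym_mats"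
  proof -
    \<comment> \<open>That the cube is antisymmetric is read off from the canonical form.\<close>
    obtain E x y where E: "orthogonal_matrix E" "B = canon E x y" using canonical_form[OF B] by metis
    show ?thesis
      unfolding E(2) canon_cube[OF E(1)] by (intro subspace_mul subspace_add subspace_asym_mats canon_asym)
  qed
  ultimately show ?thesis by (simp add: has_asym_grad_def)
qed

lemma scaleR_canon: "c *\<^sub>R canon E x y = canon E (c * x) (c * y)"
  by (simp add: canon_def scaleR_add_right)

lemma add_canon: "canon E x y + canon E x' y' = canon E (x + x') (y + y')"
  by (simp add: canon_def scaleR_add_left)

text \<open>Within a frame \<open>s = (x\<^sup>2 + y\<^sup>2) / 2\<close> and \<open>p = x y\<close>
  have partial derivatives \<open>(x, y)\<close> and \<open>(y, x)\<close>; the halves offset the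
  factor 2 in the contraction of canonical matrices.\<close>

lemma has_asym_grad_canon:
  assumes E: "orthogonal_matrix E" and xy: "x * y > 0"
  shows "has_asym_grad s_inv (canon E (x / 2) (y / 2)) (canon E x y)"
    and "has_asym_grad p_inv (canon E (y / 2) (x / 2)) (canon E x y)"
proof -
  show "has_asym_grad s_inv (canon E (x / 2) (y / 2)) (canon E x y)"
    using has_asym_grad_s_inv[OF canon_asym[of E x y]] by (simp add: scaleR_canon)
  have nz: "x \<noteq> 0" "y \<noteq> 0" using xy by auto
  have "1 / (2 * (x * y)) * (2 * ((x\<^sup>2 + y\<^sup>2) / 2) * x + - (x ^ 3)) = y / 2"
    "1 / (2 * (x * y)) * (2 * ((x\<^sup>2 + y\<^sup>2) / 2) * y + - (y ^ 3)) = x / 2"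
    using nz by (simp_all add: field_simps power2_eq_square power3_eq_cube)
  moreover have "p_inv (canon E x y) = x * y" using xy by (simp add: p_inv_canon[OF E])
  ultimately show "has_asym_grad p_inv (canon E (y / 2) (x / 2)) (canon E x y)"
    using has_asym_grad_p_inv[OF canon_asym[of E x y]] xy
    by (simp only: s_inv_canon[OF E] canon_cube[OF E] scaleR_canon add_canon)
qed

text \<open>By the chain rule the field is canonical with coefficients \<open>hs x + hp y\<close>
  and \<open>hs y + hp x\<close>, so the condition says that their product is \<open>x y\<close>.
  Dividing by \<open>x y\<close> and using \<open>x\<^sup>2 + y\<^sup>2 = 2 s\<close> gives the
  differential equation.\<close>

lemma PST_cond_iff_PST_pde:
  assumes B: "B \<in> asym_mats" and p: "p_inv B > 0"
    and ev: "\<forall>\<^sub>F X in at B within asym_mats. F X = h (s_inv X) (p_inv X)"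
    and FB: "F B = h (s_inv B) (p_inv B)"
    and h: "(\<lambda>(x, y). h x y) differentiable (at (s_inv B, p_inv B))"
  shows "PST_cond F B \<longleftrightarrow> PST_pde h (s_inv B) (p_inv B)"
proof -
  obtain E x y where E: "orthogonal_matrix E" "0 \<le> y" "y \<le> x" "B = canon E x y"
    using canonical_form[OF B] by metis
  have s: "s_inv B = (x\<^sup>2 + y\<^sup>2) / 2" and pxy: "p_inv B = x * y"
    using E by (simp_all add: s_inv_canon p_inv_canon)
  have xy: "x * y > 0" using p pxy by simp
  obtain h' where h': "((\<lambda>(x, y). h x y) has_derivative h') (at (s_inv B, p_inv B))"
    using h by (auto simp: differentiable_def)
  interpret h': bounded_linear h' using h' by (rule has_derivative_bounded_linear)
  define hs hp where "hs = h' (1, 0)" and "hp = h' (0, 1)"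
  have h'_eq: "h' (a, b) = hs * a + hp * b" for a b
    using h'.add[of "a *\<^sub>R (1, 0)" "b *\<^sub>R (0, 1)"] by (simp only: h'.scaleR hs_def hp_def) (simp add: mult.commute)
  have "((\<lambda>t. (t, p_inv B)) has_derivative (\<lambda>t. (t, 0))) (at (s_inv B))"
    by (auto intro!: derivative_eq_intros)
  from has_derivative_compose[OF this h']
  have "((\<lambda>t. h t (p_inv B)) has_real_derivative hs) (at (s_inv B))"
    by (simp add: has_field_derivative_def h'_eq)
  then have ds: "deriv (\<lambda>t. h t (p_inv B)) (s_inv B) = hs" by (rule DERIV_imp_deriv)
  have "((\<lambda>t. (s_inv B, t)) has_derivative (\<lambda>t. (0, t))) (at (p_inv B))"
    by (auto intro!: derivative_eq_intros)
  from has_derivative_compose[OF this h']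
  have "((\<lambda>t. h (s_inv B) t) has_real_derivative hp) (at (p_inv B))"
    by (simp add: has_field_derivative_def h'_eq)
  then have dp: "deriv (\<lambda>t. h (s_inv B) t) (p_inv B) = hp" by (rule DERIV_imp_deriv)
  let ?G = "canon E ((hs * x + hp * y) / 2) ((hs * y + hp * x) / 2)"
  have "((\<lambda>X. (s_inv X, p_inv X)) has_derivative
      (\<lambda>Y. (canon E (x / 2) (y / 2) \<bullet> Y, canon E (y / 2) (x / 2) \<bullet> Y))) (at B within asym_mats)"
    using has_asym_grad_canon[OF E(1) xy] by (simp add: E(4) has_asym_grad_def has_derivative_Pair)
  from has_derivative_compose[OF this h']
  have "((\<lambda>X. h (s_inv X) (p_inv X)) has_derivative
      (\<lambda>Y. h' (canon E (x / 2) (y / 2) \<bullet> Y, canon E (y / 2) (x / 2) \<bullet> Y))) (at B within asym_mats)"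
    by simp
  also have "(\<lambda>Y. h' (canon E (x / 2) (y / 2) \<bullet> Y, canon E (y / 2) (x / 2) \<bullet> Y)) = (\<lambda>Y. ?G \<bullet> Y)"
    by (simp add: h'_eq fun_eq_iff canon_def inner_add_left field_simps)
  finally have "(F has_derivative (\<lambda>Y. ?G \<bullet> Y)) (at B within asym_mats)"
    by (rule has_derivative_transform_eventually) (use ev FB B in \<open>auto simp: eq_commute\<close>)
  then have "asym_grad F B = ?G"
    by (intro asym_grad_eq B) (simp add: has_asym_grad_def canon_asym)
  then have H: "H_field F B = canon E (hs * x + hp * y) (hs * y + hp * x)"
    by (simp only: H_field_def scaleR_canon) (simp only: times_divide_eq_right nonzero_mult_div_cancel_left
        zero_neq_numeral not_False_eq_True)
  \<comment> \<open>Both contractions are multiples of the same nonzero vector, so the vector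
    equation reduces to one between coefficients.\<close>
  have "frame_normal E \<noteq> 0" using norm_frame_normal[OF E(1)] by auto
  then have "PST_cond F B \<longleftrightarrow> (hs * x + hp * y) * (hs * y + hp * x) = x * y"
    unfolding PST_cond_def H unfolding E(4) eps_contr_canon_self by simp
  also have "\<dots> \<longleftrightarrow> hs\<^sup>2 + 2 * s_inv B / p_inv B * hs * hp + hp\<^sup>2 = 1"
  proof -
    have "(hs * x + hp * y) * (hs * y + hp * x) = (x * y) * (hs\<^sup>2 + 2 * s_inv B / p_inv B * hs * hp + hp\<^sup>2)"
      unfolding s pxy using xy by (cases "x = 0 \<or> y = 0") (auto simp: field_simps power2_eq_square)
    then show ?thesis using xy by auto
  qed
  finally show ?thesis by (simp add: PST_pde_def ds dp)
qed

text \<open>With the frame of \<open>B\<close> kept fixed, \<open>x + y\<close> and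
  \<open>x - y\<close> are square roots of \<open>2 (s + p)\<close> and \<open>2 (s - p)\<close>.
  The strict inequalities keep both radicands positive, hence the roots differentiable.\<close>

lemma invariant_section:
  assumes B: "B \<in> asym_mats" and sp: "s_inv B > p_inv B" "p_inv B > 0"
  obtains \<sigma> :: "real \<times> real \<Rightarrow> mat5" where "\<sigma> (s_inv B, p_inv B) = B"
    "\<And>z. \<sigma> z \<in> asym_mats" "\<sigma> differentiable (at (s_inv B, p_inv B))"
    "\<And>s p. s > p \<Longrightarrow> p > 0 \<Longrightarrow> s_inv (\<sigma> (s, p)) = s \<and> p_inv (\<sigma> (s, p)) = p"
proof -
  obtain E x y where E: "orthogonal_matrix E" "0 \<le> y" "y \<le> x" "B = canon E x y"
    using canonical_form[OF B] by metis
  define u v where "u z = sqrt (2 * fst z + 2 * snd z)" and "v z = sqrt (2 * fst z - 2 * snd z)" for z :: "real \<times> real"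
  define \<sigma> where "\<sigma> z = canon E ((u z + v z) / 2) ((u z - v z) / 2)" for z
  have s: "s_inv B = (x\<^sup>2 + y\<^sup>2) / 2" and p: "p_inv B = x * y"
    using E by (simp_all add: s_inv_canon p_inv_canon)
  have "2 * s_inv B + 2 * p_inv B = (x + y)\<^sup>2" "2 * s_inv B - 2 * p_inv B = (x - y)\<^sup>2"
    unfolding s p by (simp_all add: power2_sum power2_diff)
  then have "u (s_inv B, p_inv B) = x + y" "v (s_inv B, p_inv B) = x - y"
    using E by (simp_all add: u_def v_def)
  then have 1: "\<sigma> (s_inv B, p_inv B) = B" by (simp add: \<sigma>_def E(4))
  have "((\<lambda>z. 2 * fst z + 2 * snd z) has_derivative (\<lambda>z. 2 * fst z + 2 * snd z)) (at (s_inv B, p_inv B))"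
    "((\<lambda>z. 2 * fst z - 2 * snd z) has_derivative (\<lambda>z. 2 * fst z - 2 * snd z)) (at (s_inv B, p_inv B))"
    by (auto intro!: derivative_eq_intros)
  from this[THEN has_derivative_real_sqrt[rotated]]
  have du: "u differentiable (at (s_inv B, p_inv B))" and dv: "v differentiable (at (s_inv B, p_inv B))"
    unfolding u_def v_def using sp by (auto intro: differentiableI)
  have 2: "\<sigma> differentiable (at (s_inv B, p_inv B))"
    unfolding \<sigma>_def canon_def
    by (intro differentiable_add differentiable_scaleR differentiable_const differentiable_divide differentiable_diff du dv) auto
  have 3: "s_inv (\<sigma> (s, p)) = s \<and> p_inv (\<sigma> (s, p)) = p" if "s > p" "p > 0" for s p
  proof -
    have "(u (s, p))\<^sup>2 = 2 * s + 2 * p" "(v (s, p))\<^sup>2 = 2 * s - 2 * p"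
      using that by (simp_all add: u_def v_def)
    moreover have "((u (s, p) + v (s, p)) / 2)\<^sup>2 + ((u (s, p) - v (s, p)) / 2)\<^sup>2 = ((u (s, p))\<^sup>2 + (v (s, p))\<^sup>2) / 2"
      "((u (s, p) + v (s, p)) / 2) * ((u (s, p) - v (s, p)) / 2) = ((u (s, p))\<^sup>2 - (v (s, p))\<^sup>2) / 4"
      by (simp_all add: power2_eq_square field_simps)
    ultimately show ?thesis
      using that by (simp add: \<sigma>_def s_inv_canon[OF E(1)] p_inv_canon[OF E(1)] del: times_divide_times_eq)
  qed
  show ?thesis using that[of \<sigma>] 1 2 3 by (simp add: \<sigma>_def canon_asym)
qed

text \<open>Near the point \<open>h\<close> is the composite of \<open>F\<close> with a
  differentiable section of the invariants, so it inherits differentiability from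
  \<open>F\<close>.\<close>

lemma function_of_invariants_differentiable:
  assumes W: "openin (top_of_set asym_mats) W" "B \<in> W" and sp: "s_inv B > p_inv B" "p_inv B > 0"
    and eq: "\<And>X. X \<in> W \<Longrightarrow> F X = h (s_inv X) (p_inv X)"
    and F: "F differentiable (at B within asym_mats)"
  shows "(\<lambda>(x, y). h x y) differentiable (at (s_inv B, p_inv B))"
proof -
  obtain T where T: "open T" "W = asym_mats \<inter> T" using W(1) by (auto simp: openin_open)
  have B: "B \<in> asym_mats" using W T by auto
  obtain \<sigma> :: "real \<times> real \<Rightarrow> mat5" where \<sigma>: "\<sigma> (s_inv B, p_inv B) = B"
    "\<And>z. \<sigma> z \<in> asym_mats" "\<sigma> differentiable (at (s_inv B, p_inv B))"
    "\<And>s p. s > p \<Longrightarrow> p > 0 \<Longrightarrow> s_inv (\<sigma> (s, p)) = s \<and> p_inv (\<sigma> (s, p)) = p"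
    using invariant_section[OF B sp] by metis
  let ?z = "(s_inv B, p_inv B)"
  obtain \<sigma>' where \<sigma>': "(\<sigma> has_derivative \<sigma>') (at ?z)" using \<sigma>(3) by (auto simp: differentiable_def)
  obtain F' where F': "(F has_derivative F') (at (\<sigma> ?z) within asym_mats)"
    using F \<sigma>(1) by (auto simp: differentiable_def)
  have d: "((\<lambda>z. F (\<sigma> z)) has_derivative (\<lambda>v. F' (\<sigma>' v))) (at ?z)"
    using \<sigma>(2) by (intro has_derivative_in_compose[OF \<sigma>' has_derivative_subset[OF F']]) auto
  have "(\<sigma> \<longlongrightarrow> B) (at ?z)" using has_derivative_continuous[OF \<sigma>'] \<sigma>(1) by (simp add: continuous_at)
  \<comment> \<open>By continuity the section stays in \<open>W\<close> near the base point, where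
    \<open>F\<close> is given by \<open>h\<close>.\<close>
  then have "\<forall>\<^sub>F z in at ?z. \<sigma> z \<in> T"
    using T W(2) by (auto intro: topological_tendstoD)
  moreover have "open {z :: real \<times> real. fst z > snd z}" "open {z :: real \<times> real. snd z > 0}"
    by (intro open_Collect_less continuous_intros)+
  from this[THEN topological_tendstoD[OF tendsto_ident_at]]
  have "\<forall>\<^sub>F z in at ?z. fst z > snd z" "\<forall>\<^sub>F z in at ?z. snd z > 0"
    using sp by simp_all
  ultimately have "\<forall>\<^sub>F z in at ?z. F (\<sigma> z) = (case z of (x, y) \<Rightarrow> h x y)"
  proof eventually_elim
    case (elim z)
    then show ?case using eq[of "\<sigma> z"] \<sigma>(4)[of "snd z" "fst z"] \<sigma>(2)[of z] T by (simp add: split_def)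
  qed
  from has_derivative_transform_eventually[OF d this] show ?thesis
    using \<sigma>(1) eq[OF W(2)] by (auto simp: differentiable_def)
qed

section \<open>The Hamiltonian\<close>

text \<open>Envelope argument: the derivative \<open>L'\<close> of \<open>Lam\<close> enters with
  total coefficient \<open>- (L + B)\<close> plus \<open>V'\<close> times the gradient of
  \<open>I_inv\<close>, which is zero by the definition of \<open>B_map\<close>. The explicit
  dependence on \<open>B\<close> leaves \<open>B / 2 - (L + B)\<close>.\<close>

lemma Ham_has_asym_grad:
  assumes U: "U \<subseteq> asym_mats" and D: "open D" "I_inv ` U \<subseteq> D" "smooth_on UNIV D V"
    and W: "W \<subseteq> asym_mats" "openin (top_of_set asym_mats) W"
    and diffeo: "diffeomorphism_on asym_mats U W (B_map V) Lam" and B: "B \<in> W"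
  shows "has_asym_grad (Ham V Lam) (- (1/2) *\<^sub>R B - Lam B) B"
proof -
  define L where "L = Lam B"
  have hom: "homeomorphism U W (B_map V) Lam" and Lam: "smooth_on asym_mats W Lam"
    using diffeo by (auto simp: diffeomorphism_on_def)
  have "Lam ` W = U" and BL: "B_map V L = B"
    using hom B by (auto simp: homeomorphism_def L_def)
  then have L: "L \<in> U" "L \<in> asym_mats" "Lam ` W \<subseteq> asym_mats" using B U by (auto simp: L_def)
  have "Ck_on (Suc 0) asym_mats W Lam" using Lam by (simp only: smooth_on_def)
  with B obtain L' where L': "(Lam has_derivative L') (at B within W)"
    by (auto simp: differentiable_def)
  have "Ck_on (Suc 0) UNIV D V" using D(3) by (simp only: smooth_on_def)
  then have "V differentiable (at (I_inv L) within D)" using D(2) L(1) by auto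
  moreover have "I_inv L \<in> D" using D(2) L(1) by blast
  ultimately have "V differentiable (at (I_inv L))" using at_within_open[OF _ D(1)] by simp
  then have "(V has_real_derivative deriv V (I_inv L)) (at (I_inv L))"
    by (simp only: DERIV_deriv_iff_real_differentiable)
  then have V: "(V has_derivative (*) (deriv V (I_inv L))) (at (I_inv L))"
    by (simp add: has_field_derivative_def)
  have I': "((\<lambda>X. I_inv (Lam X)) has_derivative (\<lambda>Y. asym_grad I_inv L \<bullet> L' Y)) (at B within W)"
    using has_asym_grad_I_inv[OF L(2)] asym_grad_I_inv[OF L(2)] L(3)
    by (intro has_derivative_in_compose[OF L'] has_derivative_subset[where t = "Lam ` W" and s = asym_mats])
      (simp_all add: has_asym_grad_def L_def)
  have sum: "L + B = deriv V (I_inv L) *\<^sub>R asym_grad I_inv L"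
    using BL by (simp add: B_map_def algebra_simps)
  have "(Ham V Lam has_derivative (\<lambda>Y. 1/4 * (B \<bullet> Y + Y \<bullet> B)
      - 1/2 * ((L + B) \<bullet> (L' Y + Y) + (L' Y + Y) \<bullet> (L + B))
      + deriv V (I_inv L) * (asym_grad I_inv L \<bullet> L' Y))) (at B within W)"
    unfolding Ham_def L_def
    by (intro has_derivative_add has_derivative_diff has_derivative_mult_right has_derivative_inner
        has_derivative_ident L' has_derivative_compose[OF I'[unfolded L_def] V[unfolded L_def]])
  also have "(\<lambda>Y. 1/4 * (B \<bullet> Y + Y \<bullet> B)
      - 1/2 * ((L + B) \<bullet> (L' Y + Y) + (L' Y + Y) \<bullet> (L + B))
      + deriv V (I_inv L) * (asym_grad I_inv L \<bullet> L' Y)) = (\<lambda>Y. (- (1/2) *\<^sub>R B - L) \<bullet> Y)"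
  proof
    fix Y
    have "deriv V (I_inv L) * (asym_grad I_inv L \<bullet> L' Y) = (L + B) \<bullet> L' Y" by (simp add: sum)
    then show "1/4 * (B \<bullet> Y + Y \<bullet> B)
      - 1/2 * ((L + B) \<bullet> (L' Y + Y) + (L' Y + Y) \<bullet> (L + B))
      + deriv V (I_inv L) * (asym_grad I_inv L \<bullet> L' Y) = (- (1/2) *\<^sub>R B - L) \<bullet> Y"
      by (simp add: inner_commute[of Y] inner_commute[of "L' Y"] inner_add_left inner_add_right inner_diff_left)
        (simp add: field_simps)
  qed
  \<comment> \<open>Smoothness of \<open>Lam\<close> gives derivatives within \<open>W\<close>;
    relative openness turns them into derivatives along all antisymmetric matrices.\<close>
  also have "at B within W = at B within asym_mats"
  proof -
    obtain T where "open T" "W = asym_mats \<inter> T" using W(2) by (auto simp: openin_open)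
    with B show ?thesis by (intro at_within_nhd[of B T]) auto
  qed
  finally have "(Ham V Lam has_derivative (\<lambda>Y. (- (1/2) *\<^sub>R B - L) \<bullet> Y)) (at B within asym_mats)" .
  moreover have "- (1/2) *\<^sub>R B - L \<in> asym_mats"
    using W(1) B L(2) by (intro subspace_diff subspace_mul subspace_asym_mats) auto
  ultimately show ?thesis by (simp add: has_asym_grad_def L_def)
qed

text \<open>With \<open>M\<close> for the gradient term, \<open>B = - L + M\<close> and
  \<open>- B - 2 L = - L - M\<close>. The two squares differ only in the sign of the cross term,
  which vanishes.\<close>

lemma eps_contr_B_map:
  assumes L: "L \<in> asym_mats"
    and B_def: "B = B_map V L"
  shows "eps_contr (- B - 2 *\<^sub>R L) (- B - 2 *\<^sub>R L) = eps_contr B B"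
proof -
  obtain E x y where E: "orthogonal_matrix E" "L = canon E x y" using canonical_form[OF L] by metis
  define c where "c = - 24 * deriv V (I_inv L)"
  \<comment> \<open>These are the coefficients of the gradient term, obtained from
    \<open>4 L\<^sup>3 + (L \<bullet> L) L\<close> by factoring
    \<open>- 4 x\<^sup>3 + 2 (x\<^sup>2 + y\<^sup>2) x\<close>.\<close>
  define x' y' where "x' = c * (2 * x * (y\<^sup>2 - x\<^sup>2))" and "y' = c * (2 * y * (x\<^sup>2 - y\<^sup>2))"
  have "deriv V (I_inv L) *\<^sub>R asym_grad I_inv L = c *\<^sub>R (4 *\<^sub>R (L ** L ** L) + (L \<bullet> L) *\<^sub>R L)"
    by (simp add: asym_grad_I_inv[OF L] c_def)
  also have "\<dots> = canon E (c * (4 * - (x ^ 3) + 2 * (x * x + y * y) * x)) (c * (4 * - (y ^ 3) + 2 * (x * x + y * y) * y))"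
    unfolding E(2) canon_cube[OF E(1)] inner_canon[OF E(1)] scaleR_canon add_canon ..
  also have "\<dots> = canon E x' y'"
    unfolding x'_def y'_def by (intro arg_cong2[where f = "canon E"]) (simp_all add: power2_eq_square power3_eq_cube algebra_simps)
  finally have B: "B = (-1) *\<^sub>R canon E x y + canon E x' y'" by (simp add: B_def B_map_def E(2))
  have "- ((-1) *\<^sub>R canon E x y + canon E x' y') - 2 *\<^sub>R L
      = (-1) *\<^sub>R canon E x y + (-1) *\<^sub>R canon E x' y'"
    by (simp add: E(2) scaleR_2)
  moreover have "x * y' + y * x' = 0" by (simp add: x'_def y'_def algebra_simps)
  then have "(-1 * x + -1 * x') * (-1 * y + -1 * y') = (-1 * x + x') * (-1 * y + y')" by (simp add: algebra_simps)
  ultimately show ?thesis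
    unfolding B by (simp only: scaleR_canon add_canon eps_contr_canon_self)
qed

section \<open>Orthogonal symmetry of the Hamiltonian\<close>

text \<open>Invariance of \<open>U\<close> keeps the conjugated preimage in the domain, where
  equivariance of \<open>B_map\<close> and the inverse property of \<open>Lam\<close> identify
  it.\<close>

lemma Lam_conj:
  assumes U: "U \<subseteq> asym_mats" "O5_invariant U" and hom: "homeomorphism U W (B_map V) Lam"
    and R: "orthogonal_matrix R" and B: "B \<in> W"
  shows "Lam (R ** B ** transpose R) = R ** Lam B ** transpose R"
proof -
  have L: "Lam B \<in> U" "B_map V (Lam B) = B" using hom B by (auto simp: homeomorphism_def)
  then have "R ** Lam B ** transpose R \<in> U" using U(2) R by (simp add: O5_invariant_def)
  moreover have "B_map V (R ** Lam B ** transpose R) = R ** B ** transpose R"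
    using B_map_conj[OF R, of "Lam B" V] L U(1) by auto
  ultimately show ?thesis using hom unfolding homeomorphism_def by metis
qed

lemma Ham_same_invariants:
  assumes U: "U \<subseteq> asym_mats" "O5_invariant U" and hom: "homeomorphism U W (B_map V) Lam"
    and W: "W \<subseteq> asym_mats" "B \<in> W" "B' \<in> W" and sp: "s_inv B = s_inv B'" "p_inv B = p_inv B'"
  shows "Ham V Lam B = Ham V Lam B'"
proof -
  obtain R where R: "orthogonal_matrix R" "B' = R ** B ** transpose R"
    using same_invariants_conj[of B B'] W sp by blast
  have "Lam B' = R ** Lam B ** transpose R"
    using Lam_conj[OF U hom R(1) W(2)] R(2) by simp
  moreover have "R ** X ** transpose R + R ** Y ** transpose R = R ** (X + Y) ** transpose R" for X Y
    by (simp add: bounded_bilinear.add_left[OF bilinear_mat5] bounded_bilinear.add_right[OF bilinear_mat5])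
  ultimately show ?thesis
    by (simp add: Ham_def R(2) inner_conj[OF R(1)] I_inv_conj[OF R(1)])
qed

text \<open>The values of \<open>h\<close> away from the invariants of \<open>W\<close> are
  arbitrary, so the differential equation is claimed for every representing \<open>h\<close>; near
  the invariants of a point of \<open>W\<close> with \<open>s > p > 0\<close> the Hamiltonian
  determines \<open>h\<close>.\<close>

theorem mainTheorem6:
  fixes U W :: "mat5 set" and D :: "real set"
    and V :: "real \<Rightarrow> real" and Lam :: "mat5 \<Rightarrow> mat5"
  assumes "U \<subseteq> asym_mats" and "openin (top_of_set asym_mats) U" and "O5_invariant U"
    and "open D" and "I_inv ` U \<subseteq> D" and "smooth_on UNIV D V"
    and "W \<subseteq> asym_mats" and "openin (top_of_set asym_mats) W"
    and "diffeomorphism_on asym_mats U W (B_map V) Lam"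
  shows
    "(\<forall>B\<in>W. Ham V Lam differentiable (at B within asym_mats)
        \<and> H_field (Ham V Lam) B = - B - 2 *\<^sub>R Lam B
        \<and> PST_cond (Ham V Lam) B)
     \<and> (\<exists>h. \<forall>B\<in>W. Ham V Lam B = h (s_inv B) (p_inv B))
     \<and> (\<forall>h. (\<forall>B\<in>W. Ham V Lam B = h (s_inv B) (p_inv B)) \<longrightarrow>
          (\<forall>B\<in>W. s_inv B > p_inv B \<and> p_inv B > 0 \<longrightarrow>
             (\<lambda>(x, y). h x y) differentiable (at (s_inv B, p_inv B))
             \<and> PST_pde h (s_inv B) (p_inv B)))
     \<and> (\<forall>F h. \<forall>B\<in>asym_mats.
          s_inv B > p_inv B \<and> p_inv B > 0
          \<and> (\<forall>\<^sub>F X in at B within asym_mats. F X = h (s_inv X) (p_inv X))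
          \<and> F B = h (s_inv B) (p_inv B)
          \<and> (\<lambda>(x, y). h x y) differentiable (at (s_inv B, p_inv B)) \<longrightarrow>
          (PST_cond F B \<longleftrightarrow> PST_pde h (s_inv B) (p_inv B)))"
proof -
  let ?H = "Ham V Lam"
  have hom: "homeomorphism U W (B_map V) Lam" using assms(9) by (simp add: diffeomorphism_on_def)
  have 1: "?H differentiable (at B within asym_mats) \<and> H_field ?H B = - B - 2 *\<^sub>R Lam B \<and> PST_cond ?H B"
    if "B \<in> W" for B
  proof -
    have grad: "has_asym_grad ?H (- (1/2) *\<^sub>R B - Lam B) B"
      using Ham_has_asym_grad[OF assms(1,4-9) that] .
    then have diff: "?H differentiable (at B within asym_mats)"
      by (auto simp: has_asym_grad_def differentiable_def)
    have H: "H_field ?H B = - B - 2 *\<^sub>R Lam B"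
      using asym_grad_eq[OF grad] that assms(7) by (auto simp: H_field_def scaleR_diff_right)
    have "Lam B \<in> asym_mats" "B_map V (Lam B) = B"
      using hom that assms(1) by (auto simp: homeomorphism_def)
    then have "PST_cond ?H B" using eps_contr_B_map[of "Lam B" B V] by (simp add: PST_cond_def H)
    with diff H show ?thesis by blast
  qed
  have "\<exists>h. \<forall>B\<in>W. ?H B = h (s_inv B) (p_inv B)"
  proof (intro exI ballI)
    fix B assume B: "B \<in> W"
    \<comment> \<open>The function is evaluated at a chosen point of \<open>W\<close> with the given
      invariants; the Hamiltonian takes the same value at all such points.\<close>
    let ?P = "\<lambda>s p X. X \<in> W \<and> s_inv X = s \<and> p_inv X = p"
    have "?P (s_inv B) (p_inv B) (SOME X. ?P (s_inv B) (p_inv B) X)"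
      by (rule someI[of _ B]) (simp add: B)
    then show "?H B = (\<lambda>s p. ?H (SOME X. ?P s p X)) (s_inv B) (p_inv B)"
      using Ham_same_invariants[OF assms(1,3) hom assms(7) B] by simp
  qed
  moreover have "(\<lambda>(x, y). h x y) differentiable (at (s_inv B, p_inv B)) \<and> PST_pde h (s_inv B) (p_inv B)"
    if h: "\<forall>B\<in>W. ?H B = h (s_inv B) (p_inv B)" and B: "B \<in> W" "s_inv B > p_inv B" "p_inv B > 0" for h B
  proof -
    have dh: "(\<lambda>(x, y). h x y) differentiable (at (s_inv B, p_inv B))"
      using function_of_invariants_differentiable[OF assms(8) B, of ?H h] h 1 B(1) by blast
    obtain T where T: "open T" "W = asym_mats \<inter> T" using assms(8) by (auto simp: openin_open)
    have "\<forall>\<^sub>F X in at B within asym_mats. ?H X = h (s_inv X) (p_inv X)"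
      using T B(1) h by (auto simp: eventually_at_topological)
    then have "PST_pde h (s_inv B) (p_inv B)"
      using PST_cond_iff_PST_pde[OF _ B(3) _ _ dh, of ?H] h 1 B(1) assms(7) by blast
    with dh show ?thesis by blast
  qed
  ultimately show ?thesis using 1 PST_cond_iff_PST_pde by blast
qed

end
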